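(* Let $n\geq2$. Suppose there exist $\alpha\in\mathbb{R}$ with $\alpha\neq-1$, $\beta\in\mathbb{R}$, and a solution $(V,\Theta)$, with $V:\mathbb{R}^n\to\mathbb{R}^n$ and $\Theta:\mathbb{R}^n\to\mathbb{R}$, of the system $$\beta\,\Theta+\frac{1}{\alpha+1}(x\cdot\nabla)\Theta+(V\cdot\nabla)\Theta=0,\qquad \mathrm{div}\,V=0\qquad\text{in }\mathbb{R}^n,$$ with $\Theta\in L^{p_1}(\mathbb{R}^n)\cap L^{p_2}(\mathbb{R}^n)$ for some $p_1,p_2$ such that $0<p_1<p_2\leq\infty$. Then $\Theta=0$.
   Context: Solutions are understood in the classical sense: $V$ is a $C^1$ vector field with bounded gradient ($V$ itself need not be bounded), $\Theta$ is $C^1$, and the equations hold pointwise. For $0<p<1$, $L^p(\mathbb{R}^n)$ is the set of measurable $f$ with $\int|f|^p\,dx<\infty$. *)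

theory Defs
  imports "HOL-Analysis.Analysis"
begin

definition C1 :: "('a::real_normed_vector \<Rightarrow> 'b::real_normed_vector) \<Rightarrow> bool" where
  "C1 f \<longleftrightarrow> (\<exists>f' :: 'a \<Rightarrow> 'a \<Rightarrow>\<^sub>L 'b.
     (\<forall>x. (f has_derivative blinfun_apply (f' x)) (at x)) \<and> continuous_on UNIV f')"

definition partial_deriv ::
    "'n \<Rightarrow> (real ^ 'n \<Rightarrow> 'b::real_normed_vector) \<Rightarrow> real ^ 'n \<Rightarrow> 'b" where
  "partial_deriv i f x = frechet_derivative f (at x) (axis i 1)"

definition divergence :: "(real ^ 'n \<Rightarrow> real ^ 'n) \<Rightarrow> real ^ 'n \<Rightarrow> real" where
  "divergence V x = (\<Sum>i\<in>UNIV. partial_deriv i V x $ i)"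

(* advect v f x is ((v . nabla) f)(x) for the vector v. *)
definition advect :: "real ^ 'n \<Rightarrow> (real ^ 'n \<Rightarrow> real) \<Rightarrow> real ^ 'n \<Rightarrow> real" where
  "advect v f x = (\<Sum>i\<in>UNIV. v $ i * partial_deriv i f x)"

definition bounded_gradient :: "(real ^ 'n \<Rightarrow> real ^ 'n) \<Rightarrow> bool" where
  "bounded_gradient V \<longleftrightarrow> (\<exists>M. \<forall>x. onorm (frechet_derivative V (at x)) \<le> M)"

definition classical_solution ::
    "real \<Rightarrow> real \<Rightarrow> (real ^ 'n \<Rightarrow> real ^ 'n) \<Rightarrow> (real ^ 'n \<Rightarrow> real) \<Rightarrow> bool" where
  "classical_solution \<alpha> \<beta> V \<Theta> \<longleftrightarrow>
     C1 V \<and> bounded_gradient V \<and> C1 \<Theta> \<and>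
     (\<forall>x. \<beta> * \<Theta> x + 1 / (\<alpha> + 1) * advect x \<Theta> x + advect (V x) \<Theta> x = 0) \<and>
     (\<forall>x. divergence V x = 0)"

(* Real-valued functions themselves, not classes modulo null sets. The exponent
   ranges over (0, \<infinity>]; for p < 1 no norm is involved. The value at p = 0 is
   not meaningful. *)
definition Lp_set :: "ennreal \<Rightarrow> ('a::euclidean_space \<Rightarrow> real) set" where
  "Lp_set p = {f \<in> borel_measurable lebesgue.
     if p = \<infinity> then \<exists>C. AE x in lebesgue. \<bar>f x\<bar> \<le> C
     else (\<integral>\<^sup>+ x. ennreal (\<bar>f x\<bar> powr enn2real p) \<partial>lebesgue) < \<infinity>}"

end

theory Submission
  imports Defs
begin

text \<open>
  Put \<open>c = 1 / (\<alpha> + 1)\<close> and \<open>W x = c x + V x\<close>. The equations say that \<open>W\<close> has the constant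
  divergence \<open>n c \<noteq> 0\<close> and that \<open>\<Theta>\<close> satisfies \<open>W \<cdot> \<nabla>\<Theta> = - \<beta> \<Theta>\<close>. Along the flow of \<open>W\<close> the
  scalar is thus multiplied by \<open>exp (- \<beta> t)\<close> while volumes grow by \<open>exp (n c t)\<close>, so that a
  finite nonzero integral \<open>\<integral> |\<Theta>|^q\<close> forces \<open>n c = q \<beta>\<close>. Two different exponents \<open>q\<close> then give
  \<open>\<beta> = 0\<close> and \<open>n c = 0\<close>, which is absurd.

  The infinitesimal form of this balance needs no flow:
  since \<open>div (|\<Theta>|^q W) = (n c - q \<beta>) |\<Theta>|^q\<close>, the relation \<open>(n c - q \<beta>) \<integral> |\<Theta>|^q = 0\<close> says that
  the integral of a divergence vanishes (\<open>power_moment_identity\<close>). Two limits justify this.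
  A cutoff of scale \<open>R\<close> makes the field compactly supported
  (\<open>transport_integral_identity\<close>); its gradient has size \<open>1 / R\<close> and lives where \<open>|x| \<le> R\<close>, and
  \<open>W\<close> grows at most linearly because \<open>V\<close> has a bounded gradient, so the error term is
  dominated by a multiple of \<open>|\<Theta>|^q\<close> and tends to zero pointwise.
  For \<open>q \<le> 1\<close> the power \<open>|s|^q\<close> is not \<open>C\<^sup>1\<close> at the origin; it is replaced by
  \<open>|s|^q s\<^sup>2 / (s\<^sup>2 + e)\<close>, and \<open>e\<close> is sent to zero, again by dominated convergence.

  The vanishing of the integral of a compactly supported divergence comes from the translation
  invariance of Lebesgue measure: difference quotients have integral zero
  (\<open>integral_directional_derivative_eq_0\<close>).
  The exponent \<open>p2 = \<infinity>\<close> reduces to a finite one, since a bounded function in \<open>L^p\<close>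
  also lies in \<open>L^(p+1)\<close>.
\<close>

section \<open>Continuously differentiable functions\<close>

text \<open>On a finite-dimensional space the derivative is continuous in operator norm as soon as each
  directional derivative is, so the product and chain rules below need no operator calculus.\<close>

lemma C1I:
  fixes f :: "'a::euclidean_space \<Rightarrow> 'b::real_normed_vector"
  assumes "\<And>x. (f has_derivative D x) (at x)"
    and "\<And>v. continuous_on UNIV (\<lambda>x. D x v)"
  shows "C1 f"
proof -
  have eq: "blinfun_apply (Blinfun (D x)) = D x" for x
    using assms(1)[of x] by (simp add: bounded_linear_Blinfun_apply has_derivative_bounded_linear)
  have "continuous_on UNIV (\<lambda>x. Blinfun (D x))"
    by (rule continuous_on_blinfun_componentwise) (simp add: eq assms(2))
  then show ?thesis
    unfolding C1_def using assms(1) eq by metis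
qed

lemma C1_has_derivative:
  assumes "C1 f"
  shows "(f has_derivative frechet_derivative f (at x)) (at x)"
  using assms unfolding C1_def by (metis differentiableI frechet_derivative_works)

lemma C1_continuous_on:
  assumes "C1 f"
  shows "continuous_on S f"
  by (meson C1_has_derivative[OF assms] continuous_at_imp_continuous_on has_derivative_continuous)

lemma C1_blinfun_frechet_derivative:
  assumes "C1 f"
  obtains f' where "\<And>x. frechet_derivative f (at x) = blinfun_apply (f' x)"
    and "continuous_on UNIV f'"
proof -
  obtain f' where f': "\<And>x. (f has_derivative blinfun_apply (f' x)) (at x)" "continuous_on UNIV f'"
    using assms unfolding C1_def by blast
  then show ?thesis
    using that[of f'] frechet_derivative_at by metis
qed

lemma C1_continuous_on_frechet_derivative:
  assumes "C1 f" and "continuous_on UNIV w"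
  shows "continuous_on UNIV (\<lambda>x. frechet_derivative f (at x) (w x))"
proof -
  obtain f' where f': "\<And>x. frechet_derivative f (at x) = blinfun_apply (f' x)" "continuous_on UNIV f'"
    using C1_blinfun_frechet_derivative[OF assms(1)] by blast
  show ?thesis
    unfolding f'(1) by (intro continuous_intros f'(2) assms(2))
qed

lemma C1_add:
  fixes f g :: "'a::euclidean_space \<Rightarrow> 'b::real_normed_vector"
  assumes "C1 f" "C1 g"
  shows "C1 (\<lambda>x. f x + g x)"
  by (rule C1I[OF has_derivative_add[OF C1_has_derivative[OF assms(1)] C1_has_derivative[OF assms(2)]]])
    (intro continuous_intros C1_continuous_on_frechet_derivative assms)

lemma C1_scaleR:
  fixes G :: "'a::euclidean_space \<Rightarrow> real" and W :: "'a \<Rightarrow> 'b::real_normed_vector"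
  assumes "C1 G" "C1 W"
  shows "C1 (\<lambda>x. G x *\<^sub>R W x)"
  by (rule C1I[OF has_derivative_scaleR[OF C1_has_derivative[OF assms(1)] C1_has_derivative[OF assms(2)]]])
    (intro continuous_intros C1_continuous_on_frechet_derivative C1_continuous_on assms)

lemma C1_component:
  fixes F :: "'a::euclidean_space \<Rightarrow> real ^ 'n"
  assumes "C1 F"
  shows "C1 (\<lambda>x. F x $ i)"
  by (rule C1I[OF bounded_linear.has_derivative[OF bounded_linear_vec_nth C1_has_derivative[OF assms]]])
    (intro continuous_intros C1_continuous_on_frechet_derivative assms)

lemma has_derivative_real_compose:
  assumes "C1 \<Theta>" and "\<And>s. (g has_real_derivative g' s) (at s)"
  shows "((\<lambda>x. g (\<Theta> x)) has_derivative (\<lambda>v. g' (\<Theta> x) * frechet_derivative \<Theta> (at x) v)) (at x)"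
  using has_derivative_compose[OF C1_has_derivative[OF assms(1)] has_field_derivative_imp_has_derivative[OF assms(2)]]
  by simp

lemma C1_real_compose:
  fixes \<Theta> :: "'a::euclidean_space \<Rightarrow> real"
  assumes "C1 \<Theta>" and "\<And>s. (g has_real_derivative g' s) (at s)" and "continuous_on UNIV g'"
  shows "C1 (\<lambda>x. g (\<Theta> x))"
  by (rule C1I[OF has_derivative_real_compose[OF assms(1,2)]])
    (intro continuous_intros C1_continuous_on_frechet_derivative C1_continuous_on assms
      continuous_on_compose2[OF assms(3)]; simp)

section \<open>Advection and divergence\<close>

lemma advect_eq_frechet_derivative:
  assumes "f differentiable at x"
  shows "advect v f x = frechet_derivative f (at x) v"
proof -
  interpret bounded_linear "frechet_derivative f (at x)"
    using assms has_derivative_bounded_linear frechet_derivative_works by blast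
  have "frechet_derivative f (at x) v = frechet_derivative f (at x) (\<Sum>i\<in>UNIV. v $ i *\<^sub>R axis i 1)"
    by (simp add: basis_expansion flip: scalar_mult_eq_scaleR)
  then show ?thesis
    by (simp add: sum scaleR advect_def partial_deriv_def)
qed

lemma advect_eqI:
  assumes "(f has_derivative D) (at x)"
  shows "advect v f x = D v"
  using assms advect_eq_frechet_derivative[of f x v] frechet_derivative_at[OF assms]
  by (auto simp: differentiable_def)

lemma C1_advect_eq:
  assumes "C1 f"
  shows "advect v f x = frechet_derivative f (at x) v"
  by (rule advect_eqI[OF C1_has_derivative[OF assms]])

lemma advect_mult:
  assumes "C1 f" "C1 g"
  shows "advect v (\<lambda>x. f x * g x) x = f x * advect v g x + advect v f x * g x"
  unfolding C1_advect_eq[OF assms(1)] C1_advect_eq[OF assms(2)]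
  by (rule advect_eqI[OF has_derivative_mult[OF C1_has_derivative[OF assms(1)] C1_has_derivative[OF assms(2)]]])

lemma advect_real_compose:
  assumes "C1 \<Theta>" and "\<And>s. (g has_real_derivative g' s) (at s)"
  shows "advect v (\<lambda>x. g (\<Theta> x)) x = g' (\<Theta> x) * advect v \<Theta> x"
  unfolding C1_advect_eq[OF assms(1)]
  by (rule advect_eqI[OF has_derivative_real_compose[OF assms]])

lemma divergence_eqI:
  assumes "(F has_derivative D) (at x)"
  shows "divergence F x = (\<Sum>i\<in>UNIV. D (axis i 1) $ i)"
  using frechet_derivative_at[OF assms] by (simp add: divergence_def partial_deriv_def)

lemma divergence_scaleR:
  assumes "C1 G" "C1 W"
  shows "divergence (\<lambda>x. G x *\<^sub>R W x) x = G x * divergence W x + advect (W x) G x"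
proof -
  have "((\<lambda>x. G x *\<^sub>R W x) has_derivative
      (\<lambda>v. G x *\<^sub>R frechet_derivative W (at x) v + frechet_derivative G (at x) v *\<^sub>R W x)) (at x)"
    by (rule has_derivative_scaleR[OF C1_has_derivative[OF assms(1)] C1_has_derivative[OF assms(2)]])
  from divergence_eqI[OF this] show ?thesis
    by (simp add: divergence_def advect_def partial_deriv_def sum.distrib sum_distrib_left mult.commute)
qed

section \<open>The integral of a divergence\<close>

text \<open>Each difference quotient of \<open>f\<close> in direction \<open>b\<close> has integral zero by translation
  invariance. For steps at most one, the quotients are supported in a fixed ball and bounded by the
  maximum of the derivative on a larger one, so the property passes to the limit.\<close>

lemma integral_directional_derivative_eq_0:
  fixes f :: "'a::euclidean_space \<Rightarrow> real"
  assumes "C1 f" and supp: "\<And>x. norm x > R \<Longrightarrow> f x = 0"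
  shows "integrable lborel (\<lambda>x. frechet_derivative f (at x) b)"
    and "(\<integral>x. frechet_derivative f (at x) b \<partial>lborel) = 0"
proof -
  define h :: "nat \<Rightarrow> real" where "h m = 1 / real (Suc m)" for m
  define q where "q m x = (f (x + h m *\<^sub>R b) - f x) / h m" for m x
  define S where "S = \<bar>R\<bar> + norm b"
  have h: "h m > 0" "h m \<le> 1" for m
    by (auto simp: h_def)
  have h0: "h \<longlonglongrightarrow> 0"
    unfolding h_def using LIMSEQ_inverse_real_of_nat by (simp add: inverse_eq_divide)
  have hb: "norm (h m *\<^sub>R b) \<le> norm b" for m
    using h[of m] by (simp add: mult_left_le_one_le)
  obtain f' where f': "\<And>x. frechet_derivative f (at x) = blinfun_apply (f' x)" "continuous_on UNIV f'"
    using C1_blinfun_frechet_derivative[OF assms(1)] by blast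
  have fd: "(f has_derivative blinfun_apply (f' x)) (at x)" for x
    using C1_has_derivative[OF assms(1), of x] by (simp add: f'(1))
  have [measurable]: "f \<in> borel_measurable borel"
    by (intro borel_measurable_continuous_onI C1_continuous_on assms)
  have "bounded (f' ` cball 0 (S + norm b))"
    by (intro compact_imp_bounded compact_continuous_image continuous_on_subset[OF f'(2)]) auto
  then obtain B where B: "B > 0" "\<And>x. x \<in> cball 0 (S + norm b) \<Longrightarrow> norm (f' x) \<le> B"
    unfolding bounded_pos by auto
  have bound: "norm (q m x) \<le> indicator (cball 0 S) x * (B * norm b)" for m x
  proof (cases "norm x \<le> S")
    case True
    have nx: "norm (x + h m *\<^sub>R b) \<le> S + norm b"
      using norm_triangle_ineq[of x "h m *\<^sub>R b"] hb[of m] True by linarith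
    have "norm (f (x + h m *\<^sub>R b) - f x) \<le> B * norm (x + h m *\<^sub>R b - x)"
      by (rule differentiable_bound[where S = "cball 0 (S + norm b)" and f' = "\<lambda>x. blinfun_apply (f' x)"])
        (use B True nx in \<open>auto simp: norm_blinfun.rep_eq[symmetric] add_increasing2
            intro: has_derivative_at_withinI[OF fd]\<close>)
    then have "norm (q m x) \<le> B * norm b"
      using h[of m] by (simp add: q_def field_simps)
    then show ?thesis using True by simp
  next
    case False
    have "norm (x + h m *\<^sub>R b) > R"
      using norm_diff_ineq[of x "h m *\<^sub>R b"] hb[of m] False by (simp add: S_def)
    moreover have "norm x > R"
      using False norm_ge_zero[of b] unfolding S_def by linarith
    ultimately show ?thesis using False by (simp add: q_def supp)
  qed
  have lim: "(\<lambda>m. q m x) \<longlonglongrightarrow> frechet_derivative f (at x) b" for x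
  proof -
    have "((\<lambda>t. f (x + t *\<^sub>R b)) has_derivative (\<lambda>t. f' (x + 0 *\<^sub>R b) (t *\<^sub>R b))) (at 0)"
      by (rule has_derivative_compose[OF _ fd]) (auto intro!: derivative_eq_intros)
    then have "((\<lambda>t. f (x + t *\<^sub>R b)) has_real_derivative f' x b) (at 0)"
      by (simp add: has_field_derivative_def blinfun.scaleR_right mult.commute[of _ "f' x b"])
    then have "((\<lambda>t. (f (x + t *\<^sub>R b) - f x) / t) \<longlongrightarrow> f' x b) (at 0)"
      by (simp add: DERIV_def)
    then show ?thesis
      unfolding q_def f'(1)
      by (rule filterlim_compose) (use h0 h in \<open>auto simp: filterlim_at less_imp_neq[symmetric]\<close>)
  qed
  have intf: "integrable lborel f"
  proof (rule Bochner_Integration.integrable_bound)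
    show "integrable lborel (\<lambda>x. indicator (cball 0 R) x * f x)"
      using borel_integrable_compact[of "cball 0 R" f] C1_continuous_on[OF assms(1)]
      by (simp add: mult.commute if_distrib indicator_def cong: if_cong)
    show "AE x in lborel. norm (f x) \<le> norm (indicator (cball 0 R) x * f x)"
      using supp by (intro AE_I2) (auto simp: indicator_def)
  qed simp
  have q0: "(\<integral>x. q m x \<partial>lborel) = 0" for m
  proof -
    let ?T = "\<lambda>x. h m *\<^sub>R b + x"
    have "integrable (distr lborel borel ?T) f"
      using intf by (simp add: lborel_distr_plus)
    then have i: "integrable lborel (\<lambda>x. f (?T x))"
      by (simp add: integrable_distr_eq)
    have "(\<integral>x. f (?T x) \<partial>lborel) = integral\<^sup>L (distr lborel borel ?T) f"
      by (simp add: integral_distr)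
    also have "\<dots> = integral\<^sup>L lborel f"
      by (simp add: lborel_distr_plus)
    finally show ?thesis
      using i intf by (simp add: q_def add.commute)
  qed
  have dom: "integrable lborel (\<lambda>x::'a. indicator (cball 0 S) x * (B * norm b))"
    using borel_integrable_compact[of "cball 0 S" "\<lambda>_. B * norm b"]
    by (simp add: if_distrib indicator_def cong: if_cong)
  have meas: "(\<lambda>x. frechet_derivative f (at x) b) \<in> borel_measurable lborel"
    by (simp, intro borel_measurable_continuous_onI C1_continuous_on_frechet_derivative assms continuous_intros)
  have measq: "q m \<in> borel_measurable lborel" for m
    unfolding q_def by measurable
  note dct = meas measq dom AE_I2[OF lim] AE_I2[OF bound]
  show "integrable lborel (\<lambda>x. frechet_derivative f (at x) b)"
    by (rule integrable_dominated_convergence[OF dct])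
  have "(\<lambda>m. \<integral>x. q m x \<partial>lborel) \<longlonglongrightarrow> (\<integral>x. frechet_derivative f (at x) b \<partial>lborel)"
    by (rule integral_dominated_convergence[OF dct])
  then show "(\<integral>x. frechet_derivative f (at x) b \<partial>lborel) = 0"
    by (simp add: q0 LIMSEQ_const_iff)
qed

lemma integral_divergence_eq_0:
  fixes F :: "real ^ 'n \<Rightarrow> real ^ 'n"
  assumes "C1 F" and "\<And>x. norm x > R \<Longrightarrow> F x = 0"
  shows "(\<integral>x. divergence F x \<partial>lborel) = 0"
proof -
  have comp: "partial_deriv i F x $ i = frechet_derivative (\<lambda>x. F x $ i) (at x) (axis i 1)" for i x
    using fun_cong[OF frechet_derivative_at[OF bounded_linear.has_derivative[OF bounded_linear_vec_nth
          C1_has_derivative[OF assms(1), of x]]], of "axis i 1"]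
    by (simp add: partial_deriv_def)
  have z: "norm x > R \<Longrightarrow> F x $ i = 0" for x i
    using assms(2) by simp
  show ?thesis
    unfolding divergence_def comp
    by (simp add: integral_directional_derivative_eq_0[OF C1_component[OF assms(1)] z])
qed

section \<open>Cutoff functions\<close>

text \<open>The origin is the only delicate point of the two functions below, \<open>(max 0 r)\<^sup>2\<close> and
  \<open>s\<^sup>2 |s|^q\<close>; there both are of smaller order than their argument.\<close>

lemma has_real_derivative_0_at_0:
  fixes f k :: "real \<Rightarrow> real"
  assumes "f 0 = 0" and "\<And>y. \<bar>f y\<bar> \<le> k y * \<bar>y\<bar>" and "(k \<longlongrightarrow> 0) (at 0)"
  shows "(f has_real_derivative 0) (at 0)"
proof -
  have "((\<lambda>y. f y / y) \<longlongrightarrow> 0) (at 0)"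
    by (rule Lim_null_comparison[OF _ assms(3)])
      (use assms(2) in \<open>auto simp: eventually_at_filter divide_le_eq\<close>)
  then show ?thesis
    using assms(1) by (simp add: DERIV_def)
qed

lemma has_real_derivative_max_0_power2:
  "((\<lambda>r. (max 0 r)\<^sup>2) has_real_derivative 2 * max 0 r) (at r)" for r :: real
proof (cases r "0::real" rule: linorder_cases)
  case less
  have "((\<lambda>r. 0) has_real_derivative 2 * max 0 r) (at r)"
    using less by simp
  then show ?thesis
    by (rule has_field_derivative_transform_within_open[where S = "{..<0}"]) (use less in auto)
next
  case equal
  have "((\<lambda>r. (max 0 r)\<^sup>2) has_real_derivative 0) (at (0::real))"
    by (rule has_real_derivative_0_at_0[where k = abs])
      (auto simp: max_def power2_eq_square intro!: tendsto_eq_intros)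
  then show ?thesis using equal by simp
next
  case greater
  have "((\<lambda>r. r\<^sup>2) has_real_derivative 2 * max 0 r) (at r)"
    using greater by (auto intro!: derivative_eq_intros)
  then show ?thesis
    by (rule has_field_derivative_transform_within_open[where S = "{0<..}"]) (use greater in auto)
qed

text \<open>The factor \<open>s\<^sup>2\<close> makes any positive power of \<open>|s|\<close> continuously differentiable.\<close>

lemma has_real_derivative_power2_mult_abs_powr:
  fixes q :: real
  assumes "q > 0"
  shows "((\<lambda>s. s\<^sup>2 * \<bar>s\<bar> powr q) has_real_derivative (q + 2) * (s * \<bar>s\<bar> powr q)) (at s)"
proof (cases "s = 0")
  case True
  have "((\<lambda>y::real. \<bar>y\<bar>) \<longlongrightarrow> 0) (at 0)"
    by (auto intro!: tendsto_eq_intros)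
  then have "((\<lambda>y::real. \<bar>y\<bar> powr q) \<longlongrightarrow> 0 powr q) (at 0)"
    by (rule tendsto_powr') (use assms in \<open>auto intro!: always_eventually\<close>)
  then have lim: "((\<lambda>y::real. \<bar>y\<bar> * \<bar>y\<bar> powr q) \<longlongrightarrow> 0) (at 0)"
    using assms by (auto intro!: tendsto_eq_intros)
  have "\<bar>y\<^sup>2 * \<bar>y\<bar> powr q\<bar> \<le> \<bar>y\<bar> * \<bar>y\<bar> powr q * \<bar>y\<bar>" for y :: real
    by (cases "y \<ge> 0") (auto simp: abs_mult power2_eq_square)
  from has_real_derivative_0_at_0[OF _ this lim] True show ?thesis
    by simp
next
  case False
  have "((\<lambda>s. \<bar>s\<bar> powr q) has_real_derivative q * \<bar>s\<bar> powr q / s) (at s)"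
  proof (cases "s > 0")
    case True
    have "((\<lambda>s. s powr q) has_real_derivative q * \<bar>s\<bar> powr q / s) (at s)"
      using True by (auto intro!: derivative_eq_intros simp: powr_diff)
    then show ?thesis
      by (rule has_field_derivative_transform_within_open[where S = "{0<..}"]) (use True in auto)
  next
    case neg: False
    have "((\<lambda>s. (- s) powr q) has_real_derivative q * \<bar>s\<bar> powr q / s) (at s)"
      using False neg by (auto intro!: derivative_eq_intros simp: powr_diff)
    then show ?thesis
      by (rule has_field_derivative_transform_within_open[where S = "{..<0}"]) (use False neg in auto)
  qed
  from DERIV_mult[OF DERIV_power[OF DERIV_ident, of 2] this] False show ?thesis
    by (simp add: algebra_simps power2_eq_square)
qed

text \<open>The squared positive part makes the cutoff \<open>C\<^sup>1\<close> across the sphere \<open>|x| = R\<close>. Its values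
  lie in \<open>[0, 1]\<close> and tend to 1 pointwise as \<open>R\<close> grows, as dominated convergence requires.\<close>

definition cutoff :: "real \<Rightarrow> 'a::real_inner \<Rightarrow> real" where
  "cutoff R x = (max 0 (1 - (x \<bullet> x) / R\<^sup>2))\<^sup>2"

lemma cutoff_eq_0:
  assumes "norm x \<ge> R" "R > 0"
  shows "cutoff R x = 0"
proof -
  have "R\<^sup>2 \<le> x \<bullet> x"
    using assms by (simp add: dot_square_norm power_mono)
  then show ?thesis
    using assms by (simp add: cutoff_def divide_simps)
qed

lemma cutoff_bounds: "0 \<le> cutoff R x" "cutoff R x \<le> 1"
  by (auto simp: cutoff_def intro!: power_le_one)

lemma cutoff_tendsto_1: "((\<lambda>R. cutoff R x) \<longlongrightarrow> 1) at_top"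
proof -
  have "((\<lambda>R. (x \<bullet> x) / R\<^sup>2) \<longlongrightarrow> 0) at_top"
    by (rule tendsto_divide_0[OF tendsto_const])
       (intro filterlim_at_top_imp_at_infinity filterlim_pow_at_top filterlim_ident; simp)
  then have "((\<lambda>R. (max 0 (1 - (x \<bullet> x) / R\<^sup>2))\<^sup>2) \<longlongrightarrow> (max 0 (1 - 0))\<^sup>2) at_top"
    by (intro tendsto_intros)
  then show ?thesis by (simp add: cutoff_def)
qed

lemma has_derivative_cutoff:
  "(cutoff R has_derivative (\<lambda>v. 2 * max 0 (1 - (x \<bullet> x) / R\<^sup>2) * (- 2 * (x \<bullet> v) / R\<^sup>2))) (at x)"
proof -
  have 1: "((\<lambda>x. 1 - (x \<bullet> x) / R\<^sup>2) has_derivative (\<lambda>v. - 2 * (x \<bullet> v) / R\<^sup>2)) (at x)"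
    by (auto intro!: derivative_eq_intros simp: inner_commute divide_inverse algebra_simps)
  from has_derivative_compose[OF this has_field_derivative_imp_has_derivative[OF has_real_derivative_max_0_power2]]
  show ?thesis
    unfolding cutoff_def[abs_def] by simp
qed

lemma C1_cutoff: "C1 (cutoff R :: 'a::euclidean_space \<Rightarrow> real)"
  by (rule C1I[OF has_derivative_cutoff]) (unfold divide_inverse, intro continuous_intros)


lemma abs_advect_cutoff_le:
  fixes x w :: "real ^ 'n"
  shows "\<bar>advect w (cutoff R) x\<bar> \<le> 4 * norm x * norm w / R\<^sup>2"
proof -
  define m where "m = max 0 (1 - (x \<bullet> x) / R\<^sup>2)"
  have m: "0 \<le> m" "m \<le> 1"
    by (auto simp: m_def)
  have "advect w (cutoff R) x = 2 * m * (- 2 * (x \<bullet> w) / R\<^sup>2)"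
    unfolding m_def by (rule advect_eqI[OF has_derivative_cutoff])
  then have "\<bar>advect w (cutoff R) x\<bar> = m * (4 * \<bar>x \<bullet> w\<bar> / R\<^sup>2)"
    using m by (simp add: abs_mult)
  also have "\<dots> \<le> 1 * (4 * (norm x * norm w) / R\<^sup>2)"
    using m by (intro mult_mono divide_right_mono mult_left_mono Cauchy_Schwarz_ineq2) auto
  finally show ?thesis by (simp add: mult.assoc)
qed

lemma advect_cutoff_tendsto_0:
  fixes x w :: "real ^ 'n"
  shows "((\<lambda>R. advect w (cutoff R) x) \<longlongrightarrow> 0) at_top"
proof (rule Lim_null_comparison)
  show "((\<lambda>R. 4 * norm x * norm w / R\<^sup>2) \<longlongrightarrow> 0) at_top"
    by (rule tendsto_divide_0[OF tendsto_const])
       (intro filterlim_at_top_imp_at_infinity filterlim_pow_at_top filterlim_ident; simp)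
qed (simp add: abs_advect_cutoff_le)

text \<open>This is where linear growth of the transporting field matters: it exactly balances
  the size \<open>|x| / R\<^sup>2\<close> of the gradient of the cutoff, uniformly in \<open>R\<close>.\<close>

lemma abs_advect_cutoff_linear_growth_le:
  fixes x w :: "real ^ 'n"
  assumes "norm w \<le> K * (1 + norm x)" and "R \<ge> 1"
  shows "\<bar>advect w (cutoff R) x\<bar> \<le> 8 * K"
proof -
  have "0 \<le> K * (1 + norm x)"
    using norm_ge_zero assms(1) by (rule order_trans)
  then have K: "0 \<le> K"
    by (metis add_pos_nonneg norm_ge_zero zero_le_mult_iff zero_less_one not_le)
  show ?thesis
  proof (cases "norm x < R")
    case True
    have "norm x * norm w \<le> R * (K * (1 + R))"
      using True assms K
      by (intro mult_mono order_trans[OF assms(1)] mult_left_mono) auto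
    also have "\<dots> \<le> R * (K * (2 * R))"
      using assms(2) K by (intro mult_left_mono) auto
    finally have "4 * norm x * norm w / R\<^sup>2 \<le> 8 * K"
      using assms(2) by (simp add: divide_le_eq power2_eq_square mult_ac)
    then show ?thesis
      using abs_advect_cutoff_le[of w R x] by linarith
  next
    case False
    then have "max 0 (1 - (x \<bullet> x) / R\<^sup>2) = 0"
      using cutoff_eq_0[of R x] assms(2) by (simp add: cutoff_def)
    then have "advect w (cutoff R) x = 0"
      using advect_eqI[OF has_derivative_cutoff, of w R x] by simp
    then show ?thesis using K by simp
  qed
qed

section \<open>Moment identities for the transported scalar\<close>

text \<open>Integrate the divergence of \<open>cutoff R x * g (\<Theta> x) *\<^sub>R W x\<close> and let \<open>R\<close> tend to infinity. The
  transport equation turns \<open>W \<cdot> \<nabla>(g \<circ> \<Theta>)\<close> into \<open>- \<beta> \<Theta> g'(\<Theta>)\<close>, so no derivative of \<open>\<Theta>\<close> is left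
  and both growth conditions on \<open>g\<close> concern \<open>|\<Theta>|^q\<close> alone.\<close>

lemma transport_integral_identity:
  fixes W :: "real ^ 'n \<Rightarrow> real ^ 'n" and \<Theta> :: "real ^ 'n \<Rightarrow> real"
  assumes C1: "C1 W" "C1 \<Theta>"
    and div: "\<And>x. divergence W x = d"
    and growth: "\<And>x. norm (W x) \<le> K * (1 + norm x)"
    and transport: "\<And>x. \<beta> * \<Theta> x + advect (W x) \<Theta> x = 0"
    and g: "\<And>s. (g has_real_derivative g' s) (at s)" "continuous_on UNIV g'"
    and bounds: "\<And>s. \<bar>g s\<bar> \<le> A * \<bar>s\<bar> powr q" "\<And>s. \<bar>s * g' s\<bar> \<le> A * \<bar>s\<bar> powr q"
    and int: "integrable lborel (\<lambda>x. \<bar>\<Theta> x\<bar> powr q)"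
  shows "(\<integral>x. d * g (\<Theta> x) - \<beta> * (\<Theta> x * g' (\<Theta> x)) \<partial>lborel) = 0"
proof -
  define u where "u R x = cutoff R x * (d * g (\<Theta> x) - \<beta> * (\<Theta> x * g' (\<Theta> x)))
      + advect (W x) (cutoff R) x * g (\<Theta> x)" for R x
  have C1g: "C1 (\<lambda>x. g (\<Theta> x))"
    by (rule C1_real_compose[OF C1(2) g])
  have C1G: "C1 (\<lambda>x. cutoff R x * g (\<Theta> x))" for R
    using C1_scaleR[OF C1_cutoff C1g] by simp
  have u: "u R x = divergence (\<lambda>x. (cutoff R x * g (\<Theta> x)) *\<^sub>R W x) x" for R x
  proof -
    have "advect (W x) \<Theta> x = - \<beta> * \<Theta> x"
      using transport[of x] by simp
    then show ?thesis
      unfolding divergence_scaleR[OF C1G C1(1)] advect_mult[OF C1_cutoff C1g]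
        advect_real_compose[OF C1(2) g(1)] div u_def
      by (simp add: algebra_simps)
  qed
  have u0: "(\<integral>x. u R x \<partial>lborel) = 0" if "R > 0" for R
    unfolding u
    by (rule integral_divergence_eq_0[OF C1_scaleR[OF C1G C1(1)], where R = R])
      (use that in \<open>simp add: cutoff_eq_0\<close>)
  have [measurable]: "g \<in> borel_measurable borel" "g' \<in> borel_measurable borel"
      "\<Theta> \<in> borel_measurable borel"
    using g by (auto intro!: borel_measurable_continuous_onI C1_continuous_on C1
        DERIV_continuous_on)
  have [measurable]: "cutoff R \<in> borel_measurable (borel :: (real ^ 'n) measure)" for R
    by (intro borel_measurable_continuous_onI C1_continuous_on C1_cutoff)
  have [measurable]: "(\<lambda>x. advect (W x) (cutoff R) x) \<in> borel_measurable borel" for R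
    unfolding C1_advect_eq[OF C1_cutoff]
    by (intro borel_measurable_continuous_onI C1_continuous_on_frechet_derivative C1_cutoff
        C1_continuous_on C1)
  have bound: "\<bar>u R x\<bar> \<le> (\<bar>d\<bar> + \<bar>\<beta>\<bar> + 8 * K) * A * \<bar>\<Theta> x\<bar> powr q" if "R \<ge> 1" for R x
  proof -
    let ?B = "A * \<bar>\<Theta> x\<bar> powr q"
    let ?h = "d * g (\<Theta> x) - \<beta> * (\<Theta> x * g' (\<Theta> x))"
    have "\<bar>?h\<bar> \<le> \<bar>d\<bar> * \<bar>g (\<Theta> x)\<bar> + \<bar>\<beta>\<bar> * \<bar>\<Theta> x * g' (\<Theta> x)\<bar>"
      unfolding abs_mult[symmetric] by (rule abs_triangle_ineq4)
    also have "\<dots> \<le> \<bar>d\<bar> * ?B + \<bar>\<beta>\<bar> * ?B"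
      by (intro add_mono mult_left_mono bounds) auto
    finally have h: "\<bar>?h\<bar> \<le> \<bar>d\<bar> * ?B + \<bar>\<beta>\<bar> * ?B" .
    have 1: "\<bar>cutoff R x * ?h\<bar> \<le> 1 * (\<bar>d\<bar> * ?B + \<bar>\<beta>\<bar> * ?B)"
      unfolding abs_mult by (intro mult_mono h) (auto simp: cutoff_bounds)
    have 2: "\<bar>advect (W x) (cutoff R) x * g (\<Theta> x)\<bar> \<le> 8 * K * ?B"
      unfolding abs_mult
      by (intro mult_mono abs_advect_cutoff_linear_growth_le[OF growth that] bounds)
        (use abs_advect_cutoff_linear_growth_le[OF growth that, of x] in auto)
    show ?thesis
      using 1 2 abs_triangle_ineq[of "cutoff R x * ?h" "advect (W x) (cutoff R) x * g (\<Theta> x)"]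
      unfolding u_def by (simp add: algebra_simps)
  qed
  have lim: "((\<lambda>R. u R x) \<longlongrightarrow> d * g (\<Theta> x) - \<beta> * (\<Theta> x * g' (\<Theta> x))) at_top" for x
  proof -
    have "((\<lambda>R. u R x) \<longlongrightarrow> 1 * (d * g (\<Theta> x) - \<beta> * (\<Theta> x * g' (\<Theta> x))) + 0 * g (\<Theta> x)) at_top"
      unfolding u_def
      by (intro tendsto_add tendsto_mult tendsto_const cutoff_tendsto_1 advect_cutoff_tendsto_0)
    then show ?thesis by simp
  qed
  have "((\<lambda>R. \<integral>x. u R x \<partial>lborel) \<longlongrightarrow> (\<integral>x. d * g (\<Theta> x) - \<beta> * (\<Theta> x * g' (\<Theta> x)) \<partial>lborel)) at_top"
  proof (rule integral_dominated_convergence_at_top)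
    show "integrable lborel (\<lambda>x. (\<bar>d\<bar> + \<bar>\<beta>\<bar> + 8 * K) * A * \<bar>\<Theta> x\<bar> powr q)"
      using int by simp
    show "\<forall>\<^sub>F R in at_top. AE x in lborel. norm (u R x) \<le> (\<bar>d\<bar> + \<bar>\<beta>\<bar> + 8 * K) * A * \<bar>\<Theta> x\<bar> powr q"
      using eventually_ge_at_top[of 1] by eventually_elim (use bound in auto)
    show "u R \<in> borel_measurable lborel" for R
      unfolding u_def by measurable
  qed (use lim in \<open>measurable; simp\<close>)+
  moreover have "((\<lambda>R. \<integral>x. u R x \<partial>lborel) \<longlongrightarrow> 0) at_top"
    by (rule tendsto_eventually) (use eventually_gt_at_top[of 0] in eventually_elim, simp add: u0)
  ultimately show ?thesis
    using tendsto_unique trivial_limit_at_top_linorder by blast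
qed

text \<open>Apply the previous identity to \<open>g s = t |s|^q\<close> with \<open>t = s\<^sup>2 / (s\<^sup>2 + e)\<close>. Then
  \<open>s g' s = ((q + 2) t - 2 t\<^sup>2) |s|^q\<close>, which is bounded by \<open>(q + 4) |s|^q\<close> since \<open>t\<close> lies in \<open>[0, 1]\<close>
  and tends to \<open>q |s|^q\<close> as \<open>e\<close> tends to zero.\<close>

lemma power_moment_identity:
  fixes W :: "real ^ 'n \<Rightarrow> real ^ 'n" and \<Theta> :: "real ^ 'n \<Rightarrow> real"
  assumes C1: "C1 W" "C1 \<Theta>"
    and div: "\<And>x. divergence W x = d"
    and growth: "\<And>x. norm (W x) \<le> K * (1 + norm x)"
    and transport: "\<And>x. \<beta> * \<Theta> x + advect (W x) \<Theta> x = 0"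
    and "q > 0"
    and int: "integrable lborel (\<lambda>x. \<bar>\<Theta> x\<bar> powr q)"
  shows "(d - q * \<beta>) * (\<integral>x. \<bar>\<Theta> x\<bar> powr q \<partial>lborel) = 0"
proof -
  define t where "t e s = s\<^sup>2 / (s\<^sup>2 + e)" for e s :: real
  define g where "g e s = s\<^sup>2 * \<bar>s\<bar> powr q / (s\<^sup>2 + e)" for e s :: real
  define g' where "g' e s = ((q + 2) * (s * \<bar>s\<bar> powr q) * (s\<^sup>2 + e) - s\<^sup>2 * \<bar>s\<bar> powr q * (2 * s))
      / ((s\<^sup>2 + e) * (s\<^sup>2 + e))" for e s :: real
  define v where "v e x = d * g e (\<Theta> x) - \<beta> * (\<Theta> x * g' e (\<Theta> x))" for e x
  have pos: "s\<^sup>2 + e > 0" if "e > 0" for s e :: real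
    using that by (simp add: add_nonneg_pos)
  have t: "0 \<le> t e s" "t e s \<le> 1" if "e > 0" for e s
    using that pos[OF that, of s] by (auto simp: t_def)
  have g_eq: "g e s = t e s * \<bar>s\<bar> powr q" for e s
    by (simp add: g_def t_def)
  have sg'_eq: "s * g' e s = ((q + 2) * t e s - 2 * (t e s)\<^sup>2) * \<bar>s\<bar> powr q" if "e > 0" for e s
  proof -
    have "s * (((q + 2) * (s * P) * D - s\<^sup>2 * P * (2 * s)) / (D * D))
        = ((q + 2) * (s\<^sup>2 / D) - 2 * (s\<^sup>2 / D)\<^sup>2) * P" if "D > 0" for D P :: real
      using that by (simp add: field_simps power2_eq_square)
    from this[OF pos[OF that]] show ?thesis
      by (simp only: g'_def t_def)
  qed
  have bg: "\<bar>g e s\<bar> \<le> (q + 4) * \<bar>s\<bar> powr q" if "e > 0" for e s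
    using t[OF that, of s] \<open>q > 0\<close> by (auto simp: g_eq abs_mult intro!: mult_right_mono)
  have bg': "\<bar>s * g' e s\<bar> \<le> (q + 4) * \<bar>s\<bar> powr q" if "e > 0" for e s
  proof -
    have "\<bar>(q + 2) * t e s - 2 * (t e s)\<^sup>2\<bar> \<le> \<bar>(q + 2) * t e s\<bar> + \<bar>2 * (t e s)\<^sup>2\<bar>"
      by (rule abs_triangle_ineq4)
    also have "\<dots> \<le> (q + 2) * 1 + 2 * 1"
      using t[OF that, of s] \<open>q > 0\<close>
      by (intro add_mono) (auto simp: abs_mult intro!: mult_left_mono power_le_one)
    finally show ?thesis
      by (auto simp: sg'_eq[OF that] abs_mult intro!: mult_right_mono)
  qed
  have deriv: "(g e has_real_derivative g' e s) (at s)" if "e > 0" for e s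
    unfolding g_def[abs_def] g'_def
  proof (rule DERIV_divide)
    show "((\<lambda>s. s\<^sup>2 * \<bar>s\<bar> powr q) has_real_derivative (q + 2) * (s * \<bar>s\<bar> powr q)) (at s)"
      by (rule has_real_derivative_power2_mult_abs_powr) fact
    show "((\<lambda>s. s\<^sup>2 + e) has_real_derivative 2 * s) (at s)"
      by (auto intro!: derivative_eq_intros)
    show "s\<^sup>2 + e \<noteq> 0"
      using pos[OF that, of s] by simp
  qed
  have cont: "continuous_on UNIV (g' e)" if "e > 0" for e
    unfolding g'_def using \<open>q > 0\<close> pos[OF that]
    by (intro continuous_intros continuous_on_powr') (auto simp: less_imp_neq[symmetric])
  have v0: "(\<integral>x. v e x \<partial>lborel) = 0" if "e > 0" for e
    unfolding v_def
    by (rule transport_integral_identity[OF C1 div growth transport deriv cont bg bg' int]) fact+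
  have lim: "((\<lambda>e. v e x) \<longlongrightarrow> (d - q * \<beta>) * \<bar>\<Theta> x\<bar> powr q) (at_right 0)" for x
  proof (cases "\<Theta> x = 0")
    case True
    then show ?thesis by (simp add: v_def g_def)
  next
    case False
    have "((\<lambda>e. t e (\<Theta> x)) \<longlongrightarrow> 1) (at_right 0)"
      unfolding t_def using False by (auto intro!: tendsto_eq_intros)
    then have "((\<lambda>e. d * (t e (\<Theta> x) * \<bar>\<Theta> x\<bar> powr q)
        - \<beta> * (((q + 2) * t e (\<Theta> x) - 2 * (t e (\<Theta> x))\<^sup>2) * \<bar>\<Theta> x\<bar> powr q))
        \<longlongrightarrow> d * (1 * \<bar>\<Theta> x\<bar> powr q) - \<beta> * (((q + 2) * 1 - 2 * 1\<^sup>2) * \<bar>\<Theta> x\<bar> powr q)) (at_right 0)"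
      by (intro tendsto_intros)
    moreover have "\<forall>\<^sub>F e in at_right 0. d * (t e (\<Theta> x) * \<bar>\<Theta> x\<bar> powr q)
        - \<beta> * (((q + 2) * t e (\<Theta> x) - 2 * (t e (\<Theta> x))\<^sup>2) * \<bar>\<Theta> x\<bar> powr q) = v e x"
      using eventually_at_right_less[of 0] by eventually_elim (simp add: v_def g_eq sg'_eq)
    ultimately have "((\<lambda>e. v e x) \<longlongrightarrow> d * (1 * \<bar>\<Theta> x\<bar> powr q)
        - \<beta> * (((q + 2) * 1 - 2 * 1\<^sup>2) * \<bar>\<Theta> x\<bar> powr q)) (at_right 0)"
      by (rule Lim_transform_eventually)
    then show ?thesis
      by (simp add: algebra_simps)
  qed
  have meas: "\<Theta> \<in> borel_measurable borel"
    by (intro borel_measurable_continuous_onI C1_continuous_on C1)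
  define e where "e n = inverse (real (Suc n))" for n
  have e: "e n > 0" for n
    by (simp add: e_def)
  have e0: "filterlim e (at_right 0) sequentially"
    using LIMSEQ_inverse_real_of_nat e
    unfolding filterlim_at e_def by (auto intro!: always_eventually)
  have "(\<lambda>n. \<integral>x. v (e n) x \<partial>lborel) \<longlonglongrightarrow> (\<integral>x. (d - q * \<beta>) * \<bar>\<Theta> x\<bar> powr q \<partial>lborel)"
  proof (rule integral_dominated_convergence)
    show "integrable lborel (\<lambda>x. (\<bar>d\<bar> + \<bar>\<beta>\<bar>) * ((q + 4) * \<bar>\<Theta> x\<bar> powr q))"
      using int by simp
    show "AE x in lborel. norm (v (e n) x) \<le> (\<bar>d\<bar> + \<bar>\<beta>\<bar>) * ((q + 4) * \<bar>\<Theta> x\<bar> powr q)" for n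
    proof (rule AE_I2)
      fix x
      have "norm (v (e n) x) \<le> \<bar>d\<bar> * \<bar>g (e n) (\<Theta> x)\<bar> + \<bar>\<beta>\<bar> * \<bar>\<Theta> x * g' (e n) (\<Theta> x)\<bar>"
        unfolding v_def abs_mult[symmetric] real_norm_def by (rule abs_triangle_ineq4)
      also have "\<dots> \<le> \<bar>d\<bar> * ((q + 4) * \<bar>\<Theta> x\<bar> powr q) + \<bar>\<beta>\<bar> * ((q + 4) * \<bar>\<Theta> x\<bar> powr q)"
        by (intro add_mono mult_left_mono bg bg' e) auto
      finally show "norm (v (e n) x) \<le> (\<bar>d\<bar> + \<bar>\<beta>\<bar>) * ((q + 4) * \<bar>\<Theta> x\<bar> powr q)"
        by (simp only: distrib_right)
    qed
    show "AE x in lborel. (\<lambda>n. v (e n) x) \<longlonglongrightarrow> (d - q * \<beta>) * \<bar>\<Theta> x\<bar> powr q"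
      by (intro AE_I2 filterlim_compose[OF lim e0])
    show "v (e n) \<in> borel_measurable lborel" for n
      unfolding v_def g_def g'_def using meas by simp
  qed (use meas in simp)
  then show ?thesis
    by (simp add: v0[OF e] LIMSEQ_const_iff)
qed

text \<open>A closed set of full Lebesgue measure is the whole space; continuity makes the zero set closed.\<close>

lemma continuous_eq_0_if_integral_abs_powr_eq_0:
  fixes f :: "'a::euclidean_space \<Rightarrow> real"
  assumes cont: "continuous_on UNIV f"
    and int: "integrable lborel (\<lambda>x. \<bar>f x\<bar> powr q)" "(\<integral>x. \<bar>f x\<bar> powr q \<partial>lborel) = 0"
  shows "f = (\<lambda>x. 0)"
proof -
  have "AE x in lborel. \<bar>f x\<bar> powr q = 0"
    using integral_nonneg_eq_0_iff_AE[OF int(1)] int(2) by simp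
  then have "AE x in lborel. f x = 0"
    by (rule AE_mp) simp
  then have "f x = 0" for x
    using mem_closed_if_AE_lebesgue[of "{x. f x = 0}" x] 
      closed_Collect_eq[OF cont continuous_on_const, of 0]
    by (auto simp: AE_completion)
  then show ?thesis by blast
qed

section \<open>Finite moments and linear growth\<close>

lemma Lp_set_integrable:
  assumes "f \<in> Lp_set p" "p \<noteq> \<infinity>" "f \<in> borel_measurable borel"
  shows "integrable lborel (\<lambda>x. \<bar>f x\<bar> powr enn2real p)"
proof (rule integrableI_nonneg)
  show "(\<integral>\<^sup>+ x. ennreal (\<bar>f x\<bar> powr enn2real p) \<partial>lborel) < \<infinity>"
    using assms by (simp add: Lp_set_def nn_integral_completion)
qed (use assms in auto)

text \<open>If \<open>|f| \<le> C\<close> almost everywhere, then \<open>|f|^(p+1) \<le> C |f|^p\<close>.\<close>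

lemma Lp_set_infinity_interpolate:
  assumes "f \<in> Lp_set \<infinity>" "f \<in> Lp_set p" "p \<noteq> \<infinity>" "f \<in> borel_measurable borel"
  shows "integrable lborel (\<lambda>x. \<bar>f x\<bar> powr (enn2real p + 1))"
proof -
  obtain C where "AE x in lebesgue. \<bar>f x\<bar> \<le> C"
    using assms(1) by (auto simp: Lp_set_def)
  then have C: "AE x in lborel. \<bar>f x\<bar> \<le> C"
    using assms(4) by (simp add: AE_completion_iff)
  show ?thesis
  proof (rule Bochner_Integration.integrable_bound)
    show "integrable lborel (\<lambda>x. C * \<bar>f x\<bar> powr enn2real p)"
      using Lp_set_integrable[OF assms(2-4)] by simp
    show "AE x in lborel. norm (\<bar>f x\<bar> powr (enn2real p + 1)) \<le> norm (C * \<bar>f x\<bar> powr enn2real p)"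
      using C
    proof eventually_elim
      case (elim x)
      then show ?case
        by (auto simp: powr_add abs_mult mult.commute intro!: mult_right_mono)
    qed
  qed (use assms(4) in measurable)
qed

lemma bounded_gradient_linear_growth:
  fixes V :: "real ^ 'n \<Rightarrow> real ^ 'n"
  assumes "C1 V" "bounded_gradient V"
  obtains M where "\<And>x. norm (V x) \<le> M * (1 + norm x)"
proof -
  obtain L where L: "\<And>x. onorm (frechet_derivative V (at x)) \<le> L"
    using assms(2) by (auto simp: bounded_gradient_def)
  have "L \<ge> 0"
    using onorm_pos_le[OF has_derivative_bounded_linear[OF C1_has_derivative[OF assms(1)]]] L
    by (rule order_trans)
  have V: "norm (V x) \<le> (norm (V 0) + L) * (1 + norm x)" for x
  proof -
    have "norm (V x - V 0) \<le> L * norm (x - 0)"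
      by (rule differentiable_bound[where S = UNIV]) (use C1_has_derivative[OF assms(1)] L in auto)
    then have "norm (V x) \<le> norm (V 0) + L * norm x"
      using norm_triangle_sub[of "V x" "V 0"] by simp
    moreover have "0 \<le> norm (V 0) * norm x"
      by simp
    ultimately show ?thesis
      using \<open>L \<ge> 0\<close> unfolding distrib_left distrib_right by linarith
  qed
  show ?thesis
    by (rule that[OF V])
qed

section \<open>Vanishing of the scalar\<close>

theorem theorem2p1:
  fixes \<alpha> \<beta> :: real and p1 p2 :: ennreal
    and V :: "real ^ 'n \<Rightarrow> real ^ 'n" and \<Theta> :: "real ^ 'n \<Rightarrow> real"
  assumes "CARD('n) \<ge> 2"
    and "\<alpha> \<noteq> -1"
    and "classical_solution \<alpha> \<beta> V \<Theta>"
    and "0 < p1" and "p1 < p2" and "p2 \<le> \<infinity>"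
    and "\<Theta> \<in> Lp_set p1 \<inter> Lp_set p2"
  shows "\<Theta> = (\<lambda>x. 0)"
proof (rule ccontr)
  assume nz: "\<Theta> \<noteq> (\<lambda>x. 0)"
  define c where "c = 1 / (\<alpha> + 1)"
  define W where "W x = c *\<^sub>R x + V x" for x
  define d where "d = real CARD('n) * c"
  have d: "d \<noteq> 0"
    using assms(2) by (simp add: d_def c_def)
  have C1: "C1 V" "C1 \<Theta>"
    using assms(3) by (auto simp: classical_solution_def)
  have lin: "((\<lambda>x. c *\<^sub>R x) has_derivative (\<lambda>v. c *\<^sub>R v)) (at x)" for x :: "real ^ 'n"
    by (auto intro!: derivative_eq_intros)
  have C1W: "C1 W"
    unfolding W_def[abs_def]
    by (rule C1_add[OF C1I[OF lin] C1(1)]) (intro continuous_intros)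
  have div: "divergence W x = d" for x
  proof -
    have "divergence V x = 0"
      using assms(3) by (auto simp: classical_solution_def)
    then show ?thesis
      using divergence_eqI[OF has_derivative_add[OF lin C1_has_derivative[OF C1(1)]], of x]
      by (simp add: W_def[abs_def] d_def divergence_def partial_deriv_def sum.distrib)
  qed
  have transport: "\<beta> * \<Theta> x + advect (W x) \<Theta> x = 0" for x
  proof -
    have "\<beta> * \<Theta> x + c * advect x \<Theta> x + advect (V x) \<Theta> x = 0"
      using assms(3) by (auto simp: classical_solution_def c_def)
    then show ?thesis
      by (simp add: W_def advect_def sum.distrib sum_distrib_left algebra_simps)
  qed
  obtain M where M: "\<And>x. norm (V x) \<le> M * (1 + norm x)"
    using bounded_gradient_linear_growth[OF C1(1)] assms(3) by (auto simp: classical_solution_def)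
  have growth: "norm (W x) \<le> (\<bar>c\<bar> + M) * (1 + norm x)" for x
    using norm_triangle_ineq[of "c *\<^sub>R x" "V x"] M[of x]
    by (simp add: W_def algebra_simps)
  have meas: "\<Theta> \<in> borel_measurable borel"
    by (intro borel_measurable_continuous_onI C1_continuous_on C1)
  have exponent: "d = q * \<beta>" if "q > 0" "integrable lborel (\<lambda>x. \<bar>\<Theta> x\<bar> powr q)" for q
  proof -
    have "(\<integral>x. \<bar>\<Theta> x\<bar> powr q \<partial>lborel) \<noteq> 0"
      using continuous_eq_0_if_integral_abs_powr_eq_0[OF C1_continuous_on[OF C1(2)] that(2)] nz
      by blast
    then show ?thesis
      using power_moment_identity[OF C1W C1(2) div growth transport that] by simp
  qed
  have fin1: "p1 \<noteq> \<infinity>"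
    using assms(5) by auto
  then have p1: "enn2real p1 > 0"
    using assms(4) by (simp add: enn2real_positive_iff top.not_eq_extremum)
  have 1: "d = enn2real p1 * \<beta>"
    using exponent[OF p1 Lp_set_integrable[OF _ fin1 meas]] assms(7) by blast
  obtain q where q: "q > enn2real p1" "integrable lborel (\<lambda>x. \<bar>\<Theta> x\<bar> powr q)"
  proof (cases "p2 = \<infinity>")
    case True
    then show ?thesis
      using that[of "enn2real p1 + 1"] Lp_set_infinity_interpolate[OF _ _ fin1 meas] assms(7) by auto
  next
    case False
    then have "enn2real p1 < enn2real p2"
      using assms(5) by (simp add: enn2real_less_iff top.not_eq_extremum ennreal_enn2real_if)
    then show ?thesis
      using that[of "enn2real p2"] Lp_set_integrable[OF _ False meas] assms(7) by auto
  qed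
  have "d = q * \<beta>"
    using exponent q p1 by simp
  then show False
    using 1 q(1) d by auto
qed

end
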